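(* Let $X=(X_i)_{i\geq 1}$ be an arbitrary changing alphabet. Then the free group $\mathcal{F}_2$ of rank two can be generated by a 2-state bi-reversible automaton over $X$ (i.e. there is a 2-state bi-reversible automaton $A$ over $X$ with $G(A)\simeq\mathcal{F}_2$) if and only if $X$ is unbounded. On the other hand, if $X$ is bounded and $A=(X,\{q_1,q_2\},\varphi,\psi)$ is an arbitrary 2-state bi-reversible automaton, then the element $A_{q_1}^{-1}A_{q_2}\in G(A)$ is of finite order, and, additionally, if this element is trivial (i.e. $A_{q_1}=A_{q_2}$), then the group $G(A)$ is finite. In particular, there is no 2-state bi-reversible Mealy automaton $A$ with $G(A)\simeq\mathcal{F}_2$.
   Context: A changing alphabet is an infinite sequence $X=(X_i)_{i\geq 1}$ of non-empty finite sets; it is called bounded if the sequence $(|X_i|)_{i\ge1}$ is bounded, and unbounded otherwise. The tree $X^*$ is the set of all finite words $x_1x_2\ldots x_t$ ($t\ge 0$, including the empty word $\epsilon$) with $x_i\in X_i$. An automaton $A=(X,Q,\varphi,\psi)$ over $X$ consists of a finite set $Q$ (states), a sequence $\varphi=(\varphi_i)_{i\ge1}$ of transition functions $\varphi_i\colon Q\times X_i\to Q$ and a sequence $\psi=(\psi_i)_{i\ge1}$ of output functions $\psi_i\colon Q\times X_i\to X_i$; it is 2-state if $|Q|=2$. If the sequences $X$, $\varphi$, $\psi$ are all constant, $A$ is a Mealy automaton. $A$ is invertible if for all $i\ge 1$, $q\in Q$ the map $\sigma_{i,q}\colon x\mapsto\psi_i(q,x)$ is a permutation of $X_i$; then the inverse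 automaton is $A^{-1}=(X,Q,\varphi',\psi')$ with $\varphi'_i(q,x)=\varphi_i(q,\sigma_{i,q}^{-1}(x))$, $\psi'_i(q,x)=\sigma_{i,q}^{-1}(x)$. $A$ is reversible if for every $i\ge 1$ and $x\in X_i$ the map $q\mapsto\varphi_i(q,x)$ is a permutation of $Q$; $A$ is bi-reversible if it is invertible and both $A$ and $A^{-1}$ are reversible. For $q\in Q$ the map $A_q\colon X^*\to X^*$ is given by $A_q(\epsilon)=\epsilon$ and $A_q(x_1\ldots x_t)=\psi_1(q^{(1)},x_1)\ldots\psi_t(q^{(t)},x_t)$, where $q^{(1)}=q$ and $q^{(i+1)}=\varphi_i(q^{(i)},x_i)$ for $1\le i<t$. If $A$ is invertible, each $A_q$ is a permutation of $X^*$, and $G(A):=\langle A_q\colon q\in Q\rangle$ is the group generated by these permutations under composition. *)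

theory Defs
  imports "HOL-Algebra.Bij" "HOL-Algebra.Elementary_Groups"
begin

text \<open>
  Levels are numbered from 0: the letter at position \<open>i\<close> of a word (counted from 0) lies in
  \<open>Xs i\<close>.
\<close>

definition changing_alphabet :: "(nat \<Rightarrow> 'a set) \<Rightarrow> bool" where
  "changing_alphabet Xs \<longleftrightarrow> (\<forall>i. finite (Xs i) \<and> Xs i \<noteq> {})"

definition bounded_alphabet :: "(nat \<Rightarrow> 'a set) \<Rightarrow> bool" where
  "bounded_alphabet Xs \<longleftrightarrow> bdd_above (range (\<lambda>i. card (Xs i)))"

definition tree_words :: "(nat \<Rightarrow> 'a set) \<Rightarrow> 'a list set" where
  "tree_words Xs = {w. \<forall>i < length w. w ! i \<in> Xs i}"

text \<open>
  The values of \<open>transition A i q x\<close> and \<open>out A i q x\<close> matter only for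
  \<open>q \<in> states A\<close> and \<open>x \<in> alphabet A i\<close>.
\<close>

record ('q, 'a) automaton =
  alphabet :: "nat \<Rightarrow> 'a set"
  states :: "'q set"
  transition :: "nat \<Rightarrow> 'q \<Rightarrow> 'a \<Rightarrow> 'q"
  out :: "nat \<Rightarrow> 'q \<Rightarrow> 'a \<Rightarrow> 'a"

definition is_automaton :: "('q, 'a) automaton \<Rightarrow> bool" where
  "is_automaton A \<longleftrightarrow> changing_alphabet (alphabet A) \<and> finite (states A) \<and>
     (\<forall>i. \<forall>q \<in> states A. \<forall>x \<in> alphabet A i.
        transition A i q x \<in> states A \<and> out A i q x \<in> alphabet A i)"

definition mealy :: "('q, 'a) automaton \<Rightarrow> bool" where
  "mealy A \<longleftrightarrow> (\<forall>i. alphabet A i = alphabet A 0 \<and>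
     (\<forall>q \<in> states A. \<forall>x \<in> alphabet A 0.
        transition A i q x = transition A 0 q x \<and> out A i q x = out A 0 q x))"

definition invertible_automaton :: "('q, 'a) automaton \<Rightarrow> bool" where
  "invertible_automaton A \<longleftrightarrow>
     (\<forall>i. \<forall>q \<in> states A. bij_betw (out A i q) (alphabet A i) (alphabet A i))"

definition inverse_automaton :: "('q, 'a) automaton \<Rightarrow> ('q, 'a) automaton" where
  "inverse_automaton A =
     \<lparr>alphabet = alphabet A,
      states = states A,
      transition = (\<lambda>i q x. transition A i q (inv_into (alphabet A i) (out A i q) x)),
      out = (\<lambda>i q x. inv_into (alphabet A i) (out A i q) x)\<rparr>"

definition reversible_automaton :: "('q, 'a) automaton \<Rightarrow> bool" where
  "reversible_automaton A \<longleftrightarrow>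
     (\<forall>i. \<forall>x \<in> alphabet A i. bij_betw (\<lambda>q. transition A i q x) (states A) (states A))"

definition bireversible_automaton :: "('q, 'a) automaton \<Rightarrow> bool" where
  "bireversible_automaton A \<longleftrightarrow>
     invertible_automaton A \<and> reversible_automaton A \<and>
     reversible_automaton (inverse_automaton A)"

fun run :: "('q, 'a) automaton \<Rightarrow> nat \<Rightarrow> 'q \<Rightarrow> 'a list \<Rightarrow> 'a list" where
  "run A i q [] = []"
| "run A i q (x # w) = out A i q x # run A (Suc i) (transition A i q x) w"

text \<open>
  Restricting to the tree makes the map extensional, as \<^const>\<open>BijGroup\<close> requires, and makes
  equality of state maps mean equality on the tree.
\<close>

definition state_map :: "('q, 'a) automaton \<Rightarrow> 'q \<Rightarrow> 'a list \<Rightarrow> 'a list" where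
  "state_map A q = restrict (run A 0 q) (tree_words (alphabet A))"

text \<open>
  The product in \<^const>\<open>BijGroup\<close> is composition of maps, the right factor being applied
  first.
\<close>

definition automaton_group :: "('q, 'a) automaton \<Rightarrow> ('a list \<Rightarrow> 'a list) monoid" where
  "automaton_group A =
     subgroup_generated (BijGroup (tree_words (alphabet A))) (state_map A ` states A)"

text \<open>
  \<^const>\<open>subgroup_generated\<close> discards generators outside the group; for an invertible automaton
  there are none.
\<close>

lemma run_in_words:
  assumes A: "is_automaton A"
  shows "q \<in> states A \<Longrightarrow> \<forall>j < length w. w ! j \<in> alphabet A (i + j) \<Longrightarrow>
    length (run A i q w) = length w \<and> (\<forall>j < length w. run A i q w ! j \<in> alphabet A (i + j))"
proof (induction w arbitrary: i q)
  case (Cons x w)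
  have x: "x \<in> alphabet A i" using Cons.prems(2) by force
  have w: "\<forall>j < length w. w ! j \<in> alphabet A (Suc i + j)"
    using Cons.prems(2) by force
  have q': "transition A i q x \<in> states A" and y: "out A i q x \<in> alphabet A i"
    using A Cons.prems(1) x by (auto simp: is_automaton_def)
  show ?case using Cons.IH[OF q' w] y by (auto simp: nth_Cons split: nat.splits)
qed simp

lemma run_inj:
  assumes A: "is_automaton A" and I: "invertible_automaton A"
  shows "q \<in> states A \<Longrightarrow> \<forall>j < length v. v ! j \<in> alphabet A (i + j) \<Longrightarrow>
    \<forall>j < length w. w ! j \<in> alphabet A (i + j) \<Longrightarrow> run A i q v = run A i q w \<Longrightarrow> v = w"
proof (induction v arbitrary: i q w)
  case Nil
  then show ?case by (cases w) auto
next
  case (Cons x v)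
  from Cons.prems(4) obtain y u where w: "w = y # u" by (cases w) auto
  have x: "x \<in> alphabet A i" and y: "y \<in> alphabet A i"
    using Cons.prems(2,3) w by force+
  have "out A i q x = out A i q y" using Cons.prems(4) w by simp
  then have xy: "x = y"
    using I x y Cons.prems(1) by (auto simp: invertible_automaton_def bij_betw_def inj_on_def)
  have "v = u"
  proof (rule Cons.IH)
    show "transition A i q x \<in> states A" using A Cons.prems(1) x by (auto simp: is_automaton_def)
    show "\<forall>j < length v. v ! j \<in> alphabet A (Suc i + j)" using Cons.prems(2) by force
    show "\<forall>j < length u. u ! j \<in> alphabet A (Suc i + j)" using Cons.prems(3) w by force
    show "run A (Suc i) (transition A i q x) v = run A (Suc i) (transition A i q x) u"
      using Cons.prems(4) w xy by simp
  qed
  then show ?case using w xy by simp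
qed

lemma run_surj:
  assumes A: "is_automaton A" and I: "invertible_automaton A"
  shows "q \<in> states A \<Longrightarrow> \<forall>j < length w. w ! j \<in> alphabet A (i + j) \<Longrightarrow>
    \<exists>v. (\<forall>j < length v. v ! j \<in> alphabet A (i + j)) \<and> run A i q v = w"
proof (induction w arbitrary: i q)
  case Nil
  show ?case by (rule exI[of _ "[]"]) simp
next
  case (Cons y w)
  have "y \<in> alphabet A i" using Cons.prems(2) by force
  moreover have "out A i q ` alphabet A i = alphabet A i"
    using I Cons.prems(1) by (simp add: invertible_automaton_def bij_betw_def)
  ultimately obtain x where x: "x \<in> alphabet A i" "out A i q x = y"
    by (metis imageE)
  have "transition A i q x \<in> states A" using A Cons.prems(1) x by (auto simp: is_automaton_def)
  moreover have "\<forall>j < length w. w ! j \<in> alphabet A (Suc i + j)" using Cons.prems(2) by force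
  ultimately obtain v where v: "\<forall>j < length v. v ! j \<in> alphabet A (Suc i + j)"
      "run A (Suc i) (transition A i q x) v = w"
    using Cons.IH by blast
  show ?case
    by (rule exI[of _ "x # v"]) (use v x in \<open>auto simp: nth_Cons split: nat.splits\<close>)
qed

lemma state_map_Bij:
  assumes "is_automaton A" "invertible_automaton A" "q \<in> states A"
  shows "state_map A q \<in> carrier (BijGroup (tree_words (alphabet A)))"
proof -
  have "bij_betw (run A 0 q) (tree_words (alphabet A)) (tree_words (alphabet A))"
    unfolding bij_betw_def
  proof
    show "inj_on (run A 0 q) (tree_words (alphabet A))"
      using run_inj[OF assms, of _ 0] by (auto simp: inj_on_def tree_words_def)
    show "run A 0 q ` tree_words (alphabet A) = tree_words (alphabet A)"
    proof
      show "run A 0 q ` tree_words (alphabet A) \<subseteq> tree_words (alphabet A)"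
        using run_in_words[OF assms(1,3), of _ 0] by (auto simp: tree_words_def)
      show "tree_words (alphabet A) \<subseteq> run A 0 q ` tree_words (alphabet A)"
        using run_surj[OF assms, of _ 0] by (force simp: tree_words_def)
    qed
  qed
  then show ?thesis
    by (simp add: BijGroup_def Bij_def state_map_def)
qed

text \<open>
  The free group on \<open>S\<close>, realised on reduced words. The pair \<open>(True, s)\<close> stands for the
  generator \<open>s\<close> and \<open>(False, s)\<close> for its inverse.
\<close>

definition inv_letter :: "bool \<times> 's \<Rightarrow> bool \<times> 's" where
  "inv_letter x = (\<not> fst x, snd x)"

fun reduced :: "(bool \<times> 's) list \<Rightarrow> bool" where
  "reduced [] = True"
| "reduced [x] = True"
| "reduced (x # y # w) = (y \<noteq> inv_letter x \<and> reduced (y # w))"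

fun reduced_Cons :: "bool \<times> 's \<Rightarrow> (bool \<times> 's) list \<Rightarrow> (bool \<times> 's) list" where
  "reduced_Cons x [] = [x]"
| "reduced_Cons x (y # w) = (if y = inv_letter x then w else x # y # w)"

definition reduce :: "(bool \<times> 's) list \<Rightarrow> (bool \<times> 's) list" where
  "reduce w = foldr reduced_Cons w []"

definition free_group :: "'s set \<Rightarrow> (bool \<times> 's) list monoid" where
  "free_group S =
     \<lparr>carrier = {w. reduced w \<and> snd ` set w \<subseteq> S},
      mult = (\<lambda>v w. reduce (v @ w)),
      one = []\<rparr>"

lemma inv_letter_inv_letter [simp]: "inv_letter (inv_letter x) = x"
  by (simp add: inv_letter_def)

lemma snd_inv_letter [simp]: "snd (inv_letter x) = snd x"
  by (simp add: inv_letter_def)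

lemma reduced_tl: "reduced (x # w) \<Longrightarrow> reduced w"
  by (cases w) auto

lemma reduced_reduced_Cons: "reduced w \<Longrightarrow> reduced (reduced_Cons x w)"
  by (cases w) (auto dest: reduced_tl)

lemma reduced_Cons_reduced: "reduced (x # w) \<Longrightarrow> reduced_Cons x w = x # w"
  by (cases w) auto

lemma reduced_Cons_cancel:
  "reduced w \<Longrightarrow> reduced_Cons x (reduced_Cons (inv_letter x) w) = w"
  by (cases w) (auto simp: reduced_Cons_reduced)

lemma reduced_foldr: "reduced w \<Longrightarrow> reduced (foldr reduced_Cons v w)"
  by (induction v) (auto simp: reduced_reduced_Cons)

lemma reduced_reduce: "reduced (reduce w)"
  by (simp add: reduce_def reduced_foldr)

lemma reduce_reduced: "reduced w \<Longrightarrow> reduce w = w"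
  unfolding reduce_def
  by (induction w) (simp, metis foldr.simps(2) o_apply reduced_Cons_reduced reduced_tl)

lemma set_reduced_Cons: "set (reduced_Cons x w) \<subseteq> insert x (set w)"
  by (cases w) auto

lemma set_reduce: "set (reduce w) \<subseteq> set w"
  unfolding reduce_def by (induction w) (use set_reduced_Cons in fastforce)+

lemma foldr_reduced_Cons:
  assumes "reduced v" "reduced w"
  shows "foldr reduced_Cons (reduced_Cons x v) w = reduced_Cons x (foldr reduced_Cons v w)"
  using reduced_Cons_cancel[OF reduced_foldr[OF assms(2)]] by (cases v) auto

lemma foldr_reduce:
  assumes "reduced w"
  shows "foldr reduced_Cons (reduce v) w = foldr reduced_Cons v w"
proof (induction v)
  case (Cons x v)
  then show ?case
    using foldr_reduced_Cons[OF reduced_reduce assms] by (simp add: reduce_def)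
qed (simp add: reduce_def)

lemma reduce_append: "reduce (v @ w) = foldr reduced_Cons v (reduce w)"
  by (simp add: reduce_def)

lemma reduce_append_reduce_left: "reduce (reduce v @ w) = reduce (v @ w)"
  by (simp add: reduce_append foldr_reduce reduced_reduce)

lemma reduce_append_reduce_right: "reduce (v @ reduce w) = reduce (v @ w)"
  by (simp add: reduce_append reduce_reduced reduced_reduce)

lemma reduce_inverse: "reduce (map inv_letter (rev w) @ w) = []"
proof (induction w)
  case (Cons x w)
  have "reduced_Cons (inv_letter x) (reduced_Cons x (reduce w)) = reduce w"
    using reduced_Cons_cancel[OF reduced_reduce, of "inv_letter x" w] by simp
  with Cons show ?case by (simp add: reduce_def)
qed (simp add: reduce_def)

lemma group_free_group: "group (free_group S)"
proof (rule groupI)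
  fix u assume u: "u \<in> carrier (free_group S)"
  show "\<one>\<^bsub>free_group S\<^esub> \<otimes>\<^bsub>free_group S\<^esub> u = u"
    using u by (simp add: free_group_def reduce_reduced)
  let ?v = "reduce (map inv_letter (rev u))"
  have "?v \<in> carrier (free_group S)"
    using u set_reduce[of "map inv_letter (rev u)"]
    by (fastforce simp: free_group_def reduced_reduce)
  moreover have "?v \<otimes>\<^bsub>free_group S\<^esub> u = \<one>\<^bsub>free_group S\<^esub>"
    by (simp add: free_group_def reduce_append_reduce_left reduce_inverse)
  ultimately show "\<exists>v \<in> carrier (free_group S). v \<otimes>\<^bsub>free_group S\<^esub> u = \<one>\<^bsub>free_group S\<^esub>"
    by blast
next
  fix u v assume "u \<in> carrier (free_group S)" "v \<in> carrier (free_group S)"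
  then show "u \<otimes>\<^bsub>free_group S\<^esub> v \<in> carrier (free_group S)"
    using set_reduce[of "u @ v"] by (fastforce simp: free_group_def reduced_reduce)
qed (simp_all add: free_group_def reduce_append_reduce_left reduce_append_reduce_right)

end

theory Submission
  imports Defs "HOL-Algebra.Multiplicative_Group"
begin

text \<open>
  Bi-reversibility makes \<open>\<tau> = \<sigma>\<^bsub>i,q\<^esub>\<inverse> \<sigma>\<^bsub>i,q'\<^esub>\<close>, for the two states \<open>q \<noteq> q'\<close>, compatible with the
  transitions: \<open>\<phi>\<^sub>i(q, \<tau> x) = \<phi>\<^sub>i(q, x)\<close>. Hence \<open>A\<^sub>q\<inverse> A\<^bsub>q'\<^esub>\<close> is the state map of an automaton whose
  outputs do not affect its transitions, and its powers are computed letter by letter. On a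
  bounded alphabet, with bound \<open>N\<close>, the power \<open>N!\<close> is therefore trivial. If moreover
  \<open>A\<^sub>q = A\<^bsub>q'\<^esub>\<close>, then the outputs do not depend on the state, and the same argument bounds the order
  of the generator of the cyclic group \<open>G(A)\<close>. A group generated by \<open>a\<close>, \<open>b\<close> with \<open>a\<inverse> b\<close> of
  finite order is not free of rank two, because \<open>a\<close> and \<open>b\<close> have the same image in the
  abelianisation \<open>\<int>\<^sup>2\<close>, which is not cyclic.

  Conversely, for an unbounded alphabet the states may be kept constant. Then only permutations of
  the levels have to be chosen, and on a level with enough letters the partial action of the
  generators on a ball of the Cayley graph of the free group extends to permutations under which
  every short non-trivial word moves the centre of the ball.
\<close>

section \<open>Homomorphisms from a free group\<close>

text \<open>The homomorphism from the free group that sends the generator \<open>s\<close> to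
  \<open>c s\<close>. It is defined on all words, so that inductions need no reducedness;
  \<open>free_eval_reduce\<close> shows that reduction preserves the value.\<close>

definition free_eval :: "('g, 'm) monoid_scheme \<Rightarrow> ('s \<Rightarrow> 'g) \<Rightarrow> (bool \<times> 's) list \<Rightarrow> 'g" where
  "free_eval G c w =
     foldr (\<lambda>x g. (if fst x then c (snd x) else inv\<^bsub>G\<^esub> c (snd x)) \<otimes>\<^bsub>G\<^esub> g) w \<one>\<^bsub>G\<^esub>"

lemma free_eval_Nil [simp]: "free_eval G c [] = \<one>\<^bsub>G\<^esub>"
  by (simp add: free_eval_def)

lemma free_eval_Cons [simp]:
  "free_eval G c (x # w) =
     (if fst x then c (snd x) else inv\<^bsub>G\<^esub> c (snd x)) \<otimes>\<^bsub>G\<^esub> free_eval G c w"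
  by (simp add: free_eval_def)

context group
begin

lemma free_eval_closed:
  assumes "c ` S \<subseteq> carrier G"
  shows "snd ` set w \<subseteq> S \<Longrightarrow> free_eval G c w \<in> carrier G"
  using assms by (induction w) auto

lemma free_eval_append:
  assumes "c ` S \<subseteq> carrier G"
  shows "snd ` set v \<subseteq> S \<Longrightarrow> snd ` set w \<subseteq> S \<Longrightarrow>
    free_eval G c (v @ w) = free_eval G c v \<otimes> free_eval G c w"
proof (induction v)
  case Nil
  then show ?case using free_eval_closed[OF assms] by simp
next
  case (Cons x v)
  have "c (snd x) \<in> carrier G" using Cons.prems assms by auto
  then show ?case using Cons free_eval_closed[OF assms, of v] free_eval_closed[OF assms, of w]
    by (simp add: m_assoc)
qed

lemma free_eval_reduced_Cons:
  assumes "c ` S \<subseteq> carrier G" "snd x \<in> S" "snd ` set w \<subseteq> S"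
  shows "free_eval G c (reduced_Cons x w) = free_eval G c (x # w)"
proof (cases w)
  case (Cons y v)
  have "c (snd x) \<in> carrier G" "free_eval G c v \<in> carrier G"
    using assms Cons free_eval_closed[OF assms(1), of v] by auto
  then show ?thesis
    using Cons by (auto simp: inv_letter_def m_assoc[symmetric])
qed simp

lemma free_eval_reduce:
  assumes "c ` S \<subseteq> carrier G"
  shows "snd ` set w \<subseteq> S \<Longrightarrow> free_eval G c (reduce w) = free_eval G c w"
proof (induction w)
  case Nil
  then show ?case by (simp add: reduce_def)
next
  case (Cons x w)
  have "snd ` set (reduce w) \<subseteq> S" using set_reduce[of w] Cons.prems by auto
  then have "free_eval G c (reduced_Cons x (reduce w)) = free_eval G c (x # reduce w)"
    using free_eval_reduced_Cons[OF assms] Cons.prems by simp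
  then show ?case using Cons by (simp add: reduce_def)
qed

lemma free_eval_hom:
  assumes "c ` S \<subseteq> carrier G"
  shows "free_eval G c \<in> hom (free_group S) G"
  by (rule homI)
    (auto simp: free_group_def free_eval_reduce[OF assms] free_eval_append[OF assms] image_Un
      intro!: free_eval_closed[OF assms])

lemma free_eval_image:
  assumes "c ` S \<subseteq> carrier G"
  shows "free_eval G c ` carrier (free_group S) = generate G (c ` S)"
proof
  have "snd ` set w \<subseteq> S \<Longrightarrow> free_eval G c w \<in> generate G (c ` S)" for w
    by (induction w) (auto intro: generate.intros)
  then show "free_eval G c ` carrier (free_group S) \<subseteq> generate G (c ` S)"
    by (auto simp: free_group_def)
next
  interpret h: group_hom "free_group S" G "free_eval G c"
    by (simp add: group_hom_def group_hom_axioms_def group_free_group is_group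
        free_eval_hom[OF assms])
  show "generate G (c ` S) \<subseteq> free_eval G c ` carrier (free_group S)"
  proof (rule generate_subgroup_incl[OF _ h.img_is_subgroup], rule image_subsetI)
    fix s assume s: "s \<in> S"
    then have "c s = free_eval G c [(True, s)]" using assms by auto
    moreover have "[(True, s)] \<in> carrier (free_group S)" using s by (simp add: free_group_def)
    ultimately show "c s \<in> free_eval G c ` carrier (free_group S)" by blast
  qed
qed

text \<open>The image of \<open>free_eval\<close> is the generated subgroup, so only injectivity is
  at stake, and a trivial kernel gives it.\<close>

lemma generated_iso_free_group:
  assumes c: "c ` S \<subseteq> carrier G"
    and ker: "\<And>w. w \<in> carrier (free_group S) \<Longrightarrow> free_eval G c w = \<one> \<Longrightarrow> w = []"
  shows "subgroup_generated G (c ` S) \<cong> free_group S"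
proof -
  interpret h: group_hom "free_group S" G "free_eval G c"
    by (simp add: group_hom_def group_hom_axioms_def group_free_group is_group
        free_eval_hom[OF c])
  have "kernel (free_group S) G (free_eval G c) = {\<one>\<^bsub>free_group S\<^esub>}"
    using ker by (auto simp: kernel_def free_group_def)
  then have "inj_on (free_eval G c) (carrier (free_group S))"
    by (rule h.trivial_ker_imp_inj)
  moreover have "free_eval G c \<in> hom (free_group S) (subgroup_generated G (c ` S))"
    using h.homh free_eval_image[OF c] c
    by (auto simp: hom_def carrier_subgroup_generated Int_absorb1)
  ultimately have "free_eval G c \<in> iso (free_group S) (subgroup_generated G (c ` S))"
    using free_eval_image[OF c] c
    by (simp add: iso_def bij_betw_def carrier_subgroup_generated Int_absorb1)
  then show ?thesis
    using group.iso_sym[OF group_free_group] by (auto simp: is_iso_def)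
qed

end

section \<open>Evaluation of words in the group of permutations of a set\<close>

lemma carrier_BijGroup [simp]: "carrier (BijGroup X) = Bij X"
  by (simp add: BijGroup_def)

lemma one_BijGroup [simp]: "\<one>\<^bsub>BijGroup X\<^esub> = (\<lambda>x \<in> X. x)"
  by (simp add: BijGroup_def)

lemma mult_BijGroup: "f \<in> Bij X \<Longrightarrow> g \<in> Bij X \<Longrightarrow> f \<otimes>\<^bsub>BijGroup X\<^esub> g = compose X f g"
  by (simp add: BijGroup_def)

text \<open>At a point of \<open>X\<close> the restrictions built into composition and inversion
  disappear, so a word acts letter by letter, its last letter first.\<close>

lemma free_eval_BijGroup_Cons:
  assumes "c ` S \<subseteq> Bij X" "snd ` set (x # w) \<subseteq> S" "y \<in> X"
  shows "free_eval (BijGroup X) c (x # w) y =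
    (if fst x then c (snd x) else inv_into X (c (snd x))) (free_eval (BijGroup X) c w y)"
proof -
  have "free_eval (BijGroup X) c w \<in> Bij X"
    using group.free_eval_closed[OF group_BijGroup, of c S X w] assms by simp
  moreover from this have "free_eval (BijGroup X) c w y \<in> X"
    using Bij_imp_funcset assms(3) by blast
  moreover have "c (snd x) \<in> Bij X" using assms(1,2) by auto
  ultimately show ?thesis
    using assms(3) by (simp add: inv_BijGroup mult_BijGroup restrict_inv_into_Bij compose_def)
qed

section \<open>An obstruction to being free of rank two\<close>

lemma (in group_hom) hom_eq_one_on_generate:
  assumes "x \<in> generate G K" "K \<subseteq> carrier G" "\<And>k. k \<in> K \<Longrightarrow> h k = \<one>\<^bsub>H\<^esub>"
  shows "h x = \<one>\<^bsub>H\<^esub>"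
proof -
  have "x \<in> carrier G \<and> h x = \<one>\<^bsub>H\<^esub>"
    using assms(1) by induction (use assms(2,3) in auto)
  then show ?thesis by simp
qed

text \<open>Every homomorphism to the integers identifies \<open>a\<close> and \<open>b\<close>,
  hence is determined by its value at \<open>a\<close>. The two coordinate homomorphisms of a free
  group of rank two would then be linearly dependent.\<close>

lemma (in group) two_generated_torsion_quotient_not_free:
  assumes ab: "a \<in> carrier G" "b \<in> carrier G" and gen: "carrier G = generate G {a, b}"
    and n: "n > 0" "(inv a \<otimes> b) [^] (n::nat) = \<one>"
  shows "\<not> G \<cong> free_group {..<2::nat}"
proof
  assume "G \<cong> free_group {..<2::nat}"
  then obtain f where f: "f \<in> iso G (free_group {..<2::nat})"
    by (auto simp: is_iso_def)
  \<comment> \<open>\<open>h c\<close> is the homomorphism to the integers that takes the value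
    \<open>c s\<close> at the element corresponding under \<open>f\<close> to the generator
    \<open>s\<close>.\<close>
  define h :: "(nat \<Rightarrow> int) \<Rightarrow> 'a \<Rightarrow> int" where "h = (\<lambda>c x. free_eval integer_group c (f x))"
  have h: "group_hom G integer_group (h c)" for c
    using Group.hom_compose[of f G "free_group {..<2::nat}" "free_eval integer_group c" integer_group]
      f group.free_eval_hom[of integer_group c "{..<2::nat}"]
    by (simp add: group_hom_def group_hom_axioms_def is_group iso_def h_def comp_def)
  have surj: "\<exists>x \<in> carrier G. h c x = c s" if "s < 2" for c s
  proof -
    have "[(True, s)] \<in> f ` carrier G"
      using f that by (auto simp: iso_def bij_betw_def free_group_def)
    then obtain x where "x \<in> carrier G" "f x = [(True, s)]" by (metis imageE)
    then show ?thesis by (intro bexI[of _ x]) (simp_all add: h_def)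
  qed
  have eq: "h c a = h c b" for c
  proof -
    interpret group_hom G integer_group "h c" by (rule h)
    \<comment> \<open>The right-hand side is the image of the identity, so it is 0, and the integers
      are torsion-free.\<close>
    have "int n * (h c b - h c a) = h c ((inv a \<otimes> b) [^] n)"
      using ab by (simp add: hom_nat_pow)
    then show ?thesis using n by simp
  qed
  \<comment> \<open>If \<open>h c\<close> kills \<open>a\<close>, it kills \<open>b\<close> as well,
    hence the whole group.\<close>
  have zero: "c s = 0" if "h c a = 0" "s < 2" for c s
  proof -
    interpret group_hom G integer_group "h c" by (rule h)
    obtain x where "x \<in> carrier G" "h c x = c s" using surj[OF \<open>s < 2\<close>] by blast
    moreover have "h c k = \<one>\<^bsub>integer_group\<^esub>" if "k \<in> {a, b}" for k
      using that eq[of c] \<open>h c a = 0\<close> by auto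
    ultimately show ?thesis
      using hom_eq_one_on_generate[of x "{a, b}"] gen ab by simp
  qed
  \<comment> \<open>\<open>u\<close> and \<open>v\<close> are the values of the coordinate
    homomorphisms at \<open>a\<close>; the combination with coefficients \<open>v\<close> and
    \<open>- u\<close> vanishes there.\<close>
  define u where "u = h (\<lambda>s. if s = 0 then 1 else 0) a"
  define v where "v = h (\<lambda>s. if s = 0 then 0 else 1) a"
  have "free_eval integer_group (\<lambda>s. if s = 0 then v else - u) w =
      v * free_eval integer_group (\<lambda>s. if s = 0 then 1 else 0) w -
      u * free_eval integer_group (\<lambda>s. if s = 0 then 0 else 1) w" for w :: "(bool \<times> nat) list"
    by (induction w) (auto simp: algebra_simps)
  then have "h (\<lambda>s. if s = 0 then v else - u) a = 0"
    by (simp add: h_def u_def v_def)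
  from zero[OF this, of 0] zero[OF this, of 1] have "u = 0" by auto
  \<comment> \<open>Now the first coordinate homomorphism itself kills \<open>a\<close>, although it
    takes the value 1 on a generator.\<close>
  then have "h (\<lambda>s. if s = 0 then 1 else 0) a = 0" unfolding u_def .
  from zero[OF this, of 0] show False by simp
qed

section \<open>Powers of state maps\<close>

text \<open>The period of \<open>x\<close> under \<open>f\<close> is at most \<open>card X\<close>,
  hence divides \<open>fact N\<close>.\<close>

lemma funpow_fact_fixed:
  assumes X: "finite X" "card X \<le> N" and f: "bij_betw f X X" and x: "x \<in> X"
  shows "(f ^^ fact N) x = x"
proof -
  have in_X: "(f ^^ k) y \<in> X" if "y \<in> X" for k y
    using that f by (induction k) (auto simp: bij_betw_def)
  have inj: "inj_on (f ^^ k) X" for k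
  proof (induction k)
    case (Suc k)
    show ?case
      using Suc f in_X by (auto simp: inj_on_def bij_betw_def)
  qed simp
  \<comment> \<open>The \<open>card X + 1\<close> iterates with exponents from 0 to
    \<open>card X\<close> lie in \<open>X\<close>, so two of them coincide.\<close>
  have "card ((\<lambda>k. (f ^^ k) x) ` {..card X}) \<le> card X"
    using in_X[OF x] X by (intro card_mono) auto
  then have "\<not> inj_on (\<lambda>k. (f ^^ k) x) {..card X}"
    by (intro pigeonhole) simp
  then obtain i j where ij: "i < j" "j \<le> card X" "(f ^^ i) x = (f ^^ j) x"
    by (auto simp: inj_on_def) (metis linorder_neqE_nat)
  have "(f ^^ i) ((f ^^ (j - i)) x) = (f ^^ i) x"
    using ij by (metis funpow_add le_add_diff_inverse less_imp_le_nat o_apply)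
  then have period: "(f ^^ (j - i)) x = x"
    using inj in_X x by (meson inj_onD)
  have "j - i dvd fact N"
    using ij X by (intro dvd_fact) auto
  then obtain m where "fact N = m * (j - i)"
    by (metis dvd_def mult.commute)
  moreover have "(f ^^ (m * (j - i))) x = x"
    using period by (induction m) (auto simp: funpow_add)
  ultimately show ?thesis by simp
qed

text \<open>By \<open>stable\<close>, reading the output word leads through the same states as
  reading the input word. Repeated passes therefore iterate, at each position, one fixed
  permutation.\<close>

lemma state_map_pow_BijGroup:
  assumes A: "is_automaton A" "invertible_automaton A" "q \<in> states A"
    and stable: "\<And>i q x. q \<in> states A \<Longrightarrow> x \<in> alphabet A i \<Longrightarrow>
      transition A i q (out A i q x) = transition A i q x"
  shows "state_map A q [^]\<^bsub>BijGroup (tree_words (alphabet A))\<^esub> (n::nat) =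
    state_map (A\<lparr>out := \<lambda>i q. out A i q ^^ n\<rparr>) q"
proof (induction n)
  case 0
  have "run (A\<lparr>out := \<lambda>i q. out A i q ^^ 0\<rparr>) i q w = w" for i q w
    by (induction w arbitrary: i q) auto
  then have "run (A\<lparr>out := \<lambda>i q. out A i q ^^ 0\<rparr>) 0 q = (\<lambda>w. w)" by blast
  then show ?case
    by (simp add: BijGroup_def state_map_def id_def)
next
  case (Suc n)
  let ?W = "tree_words (alphabet A)" and ?B = "A\<lparr>out := \<lambda>i q. out A i q ^^ n\<rparr>"
  have pow: "run ?B i q (run A i q w) = run (A\<lparr>out := \<lambda>i q. out A i q ^^ Suc n\<rparr>) i q w"
    if "q \<in> states A" "\<forall>j < length w. w ! j \<in> alphabet A (i + j)" for i q w
    using that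
  proof (induction w arbitrary: i q)
    case (Cons x w)
    have x: "x \<in> alphabet A i" and w: "\<forall>j < length w. w ! j \<in> alphabet A (Suc i + j)"
      using Cons.prems(2) by force+
    have "transition A i q x \<in> states A"
      using A Cons.prems(1) x by (auto simp: is_automaton_def)
    from Cons.IH[OF this w] show ?case
      using stable[OF Cons.prems(1) x] by (simp add: funpow_swap1)
  qed simp
  interpret group "BijGroup ?W" by (rule group_BijGroup)
  \<comment> \<open>The second map is a bijection because the induction hypothesis writes it as a
    power of the first.\<close>
  have a: "state_map A q \<in> Bij ?W" "state_map ?B q \<in> Bij ?W"
    using state_map_Bij[OF A] Suc nat_pow_closed[OF state_map_Bij[OF A], of n]
    by (auto simp: BijGroup_def)
  have "run A 0 q w \<in> ?W" if "w \<in> ?W" for w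
    using run_in_words[OF A(1,3), of w 0] that by (auto simp: tree_words_def)
  moreover have "run ?B 0 q (run A 0 q w) = run (A\<lparr>out := \<lambda>i q. out A i q ^^ Suc n\<rparr>) 0 q w"
    if "w \<in> ?W" for w
    using pow[OF A(3), of w 0] that by (simp add: tree_words_def)
  ultimately have "compose ?W (state_map ?B q) (state_map A q) =
      state_map (A\<lparr>out := \<lambda>i q. out A i q ^^ Suc n\<rparr>) q"
    by (auto simp: compose_def state_map_def restrict_def fun_eq_iff simp del: funpow.simps)
  moreover have "state_map A q [^]\<^bsub>BijGroup ?W\<^esub> Suc n =
      compose ?W (state_map ?B q) (state_map A q)"
    using Suc a by (simp add: BijGroup_def)
  ultimately show ?case by (simp only:)
qed

text \<open>One bound \<open>N\<close> for all levels makes the single exponent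
  \<open>fact N\<close> trivialise every output permutation at once.\<close>

lemma state_map_finite_order:
  assumes A: "is_automaton A" "invertible_automaton A" "q \<in> states A"
    and bdd: "bounded_alphabet (alphabet A)"
    and stable: "\<And>i q x. q \<in> states A \<Longrightarrow> x \<in> alphabet A i \<Longrightarrow>
      transition A i q (out A i q x) = transition A i q x"
  shows "\<exists>n::nat. n > 0 \<and>
    state_map A q [^]\<^bsub>BijGroup (tree_words (alphabet A))\<^esub> n =
    \<one>\<^bsub>BijGroup (tree_words (alphabet A))\<^esub>"
proof -
  obtain N where N: "\<And>i. card (alphabet A i) \<le> N"
    using bdd by (auto simp: bounded_alphabet_def bdd_above_def)
  let ?B = "A\<lparr>out := \<lambda>i q. out A i q ^^ fact N\<rparr>"
  have "run ?B i q w = w" if "q \<in> states A" "\<forall>j < length w. w ! j \<in> alphabet A (i + j)" for i q w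
    using that
  proof (induction w arbitrary: i q)
    case (Cons x w)
    have x: "x \<in> alphabet A i" and w: "\<forall>j < length w. w ! j \<in> alphabet A (Suc i + j)"
      using Cons.prems(2) by force+
    have "transition A i q x \<in> states A"
      using A Cons.prems(1) x by (auto simp: is_automaton_def)
    from Cons.IH[OF this w] show ?case
      using funpow_fact_fixed[of "alphabet A i" N "out A i q" x] N[of i] x A Cons.prems(1)
      by (simp add: is_automaton_def changing_alphabet_def invertible_automaton_def)
  qed simp
  from this[OF A(3), of _ 0]
  have "state_map ?B q = \<one>\<^bsub>BijGroup (tree_words (alphabet A))\<^esub>"
    by (auto simp: state_map_def BijGroup_def tree_words_def restrict_def fun_eq_iff)
  then show ?thesis
    using state_map_pow_BijGroup[OF A stable, of "fact N"] by (intro exI[of _ "fact N"]) simp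
qed

section \<open>Bi-reversible automata with two states\<close>

locale two_state_bireversible =
  fixes A :: "('q, 'a) automaton" and p q :: 'q
  assumes automaton: "is_automaton A" and bireversible: "bireversible_automaton A"
    and states: "states A = {p, q}" "p \<noteq> q"
begin

lemma invertible: "invertible_automaton A"
  using bireversible by (simp add: bireversible_automaton_def)

definition other :: "'q \<Rightarrow> 'q" where
  "other s = (if s = p then q else p)"

lemma other_in_states [simp]: "other s \<in> states A"
  by (simp add: other_def states)

lemma other_neq [simp]: "s \<in> states A \<Longrightarrow> other s \<noteq> s"
  using states by (auto simp: other_def)

lemma neq_imp_other: "s \<in> states A \<Longrightarrow> t \<in> states A \<Longrightarrow> s \<noteq> t \<Longrightarrow> t = other s"
  using states by (auto simp: other_def)

lemma transition_in_states:
  "s \<in> states A \<Longrightarrow> x \<in> alphabet A i \<Longrightarrow> transition A i s x \<in> states A"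
  using automaton by (simp add: is_automaton_def)

text \<open>Each letter permutes the two states, and a permutation of a two-element set commutes
  with the swap.\<close>

lemma transition_other:
  assumes "s \<in> states A" "x \<in> alphabet A i"
  shows "transition A i (other s) x = other (transition A i s x)"
proof (rule neq_imp_other)
  have "inj_on (\<lambda>q. transition A i q x) (states A)"
    using bireversible assms
    by (simp add: bireversible_automaton_def reversible_automaton_def bij_betw_def)
  then show "transition A i s x \<noteq> transition A i (other s) x"
    using assms by (metis inj_onD other_in_states other_neq)
qed (use assms transition_in_states in auto)

text \<open>Only the state \<open>s\<close> of one run has to be stored: by
  \<open>transition_other\<close>, the run of \<open>A\<close> from the other state stays in
  \<open>other s\<close> throughout. The output undoes that of \<open>s\<close> after applying that
  of \<open>other s\<close>.\<close>

definition quotient_automaton :: "('q, 'a) automaton" where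
  "quotient_automaton =
     A\<lparr>out := \<lambda>i s x. inv_into (alphabet A i) (out A i s) (out A i (other s) x)\<rparr>"

lemma quotient_automaton_simps [simp]:
  "alphabet quotient_automaton = alphabet A"
  "states quotient_automaton = states A"
  "transition quotient_automaton = transition A"
  "out quotient_automaton i s x = inv_into (alphabet A i) (out A i s) (out A i (other s) x)"
  by (simp_all add: quotient_automaton_def)

lemma bij_out: "s \<in> states A \<Longrightarrow> bij_betw (out A i s) (alphabet A i) (alphabet A i)"
  using invertible by (simp add: invertible_automaton_def)

lemma bij_out_quotient:
  assumes "s \<in> states A"
  shows "bij_betw (out quotient_automaton i s) (alphabet A i) (alphabet A i)"
  using bij_betw_trans[OF bij_out[OF other_in_states] bij_betw_inv_into[OF bij_out[OF assms]],
      of i s]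
  by (simp add: comp_def cong: bij_betw_cong)

lemma quotient_is_automaton: "is_automaton quotient_automaton"
  using automaton bij_betwE[OF bij_out_quotient] by (simp add: is_automaton_def)

lemma quotient_invertible: "invertible_automaton quotient_automaton"
  using bij_out_quotient by (simp add: invertible_automaton_def)

lemma out_out_quotient:
  assumes "s \<in> states A" "x \<in> alphabet A i"
  shows "out A i s (out quotient_automaton i s x) = out A i (other s) x"
  using bij_betw_inv_into_right[OF bij_out[OF assms(1)]]
    bij_betwE[OF bij_out[OF other_in_states]] assms by simp

text \<open>Reversibility of the inverse automaton, applied to the output letter \<open>?y\<close>,
  makes \<open>?\<theta>\<close> a permutation of the states. It sends \<open>other s\<close> to
  \<open>other (transition A i s x)\<close>, so it must send \<open>s\<close> to the remaining
  state, \<open>transition A i s x\<close>.\<close>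

lemma transition_out_quotient:
  assumes "s \<in> states A" "x \<in> alphabet A i"
  shows "transition A i s (out quotient_automaton i s x) = transition A i s x"
proof -
  let ?y = "out A i (other s) x"
  let ?\<theta> = "\<lambda>q. transition A i q (inv_into (alphabet A i) (out A i q) ?y)"
  have "?y \<in> alphabet A i" using bij_betwE[OF bij_out[OF other_in_states]] assms by blast
  then have "bij_betw ?\<theta> (states A) (states A)"
    using bireversible
    by (simp add: bireversible_automaton_def reversible_automaton_def inverse_automaton_def)
  then have inj: "inj_on ?\<theta> (states A)" and closed: "?\<theta> s \<in> states A"
    using assms(1) bij_betwE by (blast dest: bij_betw_imp_inj_on)+
  have "?\<theta> (other s) \<noteq> ?\<theta> s"
    by (rule inj_on_contraD[OF inj]) (use assms in simp_all)
  moreover have "?\<theta> (other s) = other (transition A i s x)"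
    using bij_betw_inv_into_left[OF bij_out[OF other_in_states]] assms transition_other by simp
  ultimately have "?\<theta> s \<noteq> other (transition A i s x)" by simp
  with closed neq_imp_other[OF transition_in_states[OF assms] closed] have "?\<theta> s = transition A i s x"
    by metis
  then show ?thesis by simp
qed

lemma run_run_quotient:
  "s \<in> states A \<Longrightarrow> \<forall>j < length w. w ! j \<in> alphabet A (i + j) \<Longrightarrow>
    run A i s (run quotient_automaton i s w) = run A i (other s) w"
proof (induction w arbitrary: i s)
  case (Cons x w)
  have x: "x \<in> alphabet A i" and w: "\<forall>j < length w. w ! j \<in> alphabet A (Suc i + j)"
    using Cons.prems(2) by force+
  show ?case
    using Cons.IH[OF transition_in_states[OF Cons.prems(1) x] w]
      out_out_quotient[OF Cons.prems(1) x] transition_out_quotient[OF Cons.prems(1) x]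
      transition_other[OF Cons.prems(1) x]
    by simp
qed simp

abbreviation tree_group where "tree_group \<equiv> BijGroup (tree_words (alphabet A))"

lemma state_map_closed: "s \<in> states A \<Longrightarrow> state_map A s \<in> carrier tree_group"
  by (rule state_map_Bij[OF automaton invertible])

lemma quotient_state_map_closed:
  "s \<in> states A \<Longrightarrow> state_map quotient_automaton s \<in> carrier tree_group"
  using state_map_Bij[OF quotient_is_automaton quotient_invertible] by simp

text \<open>\<open>run_run_quotient\<close> says that the state map of \<open>s\<close> after that
  of the quotient is the state map of \<open>other s\<close>; the left factor is then cancelled in
  the group.\<close>

lemma state_map_quotient:
  assumes "s \<in> states A"
  shows "inv\<^bsub>tree_group\<^esub> state_map A s \<otimes>\<^bsub>tree_group\<^esub> state_map A (other s) =
    state_map quotient_automaton s"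
proof -
  interpret group tree_group by (rule group_BijGroup)
  let ?W = "tree_words (alphabet A)" and ?d = "state_map quotient_automaton s"
  have "run quotient_automaton 0 s w \<in> ?W" if "w \<in> ?W" for w
    using run_in_words[OF quotient_is_automaton, of s w 0] assms that
    by (auto simp: tree_words_def)
  then have "compose ?W (state_map A s) ?d = state_map A (other s)"
    using run_run_quotient[OF assms, of _ 0]
    by (auto simp: compose_def state_map_def restrict_def fun_eq_iff tree_words_def)
  then have "state_map A s \<otimes>\<^bsub>tree_group\<^esub> ?d = state_map A (other s)"
    using state_map_closed[OF assms] quotient_state_map_closed[OF assms]
    by (simp add: BijGroup_def)
  then show ?thesis
    using state_map_closed quotient_state_map_closed assms
    by (metis inv_solve_left other_in_states)
qed

lemma carrier_automaton_group:
  "carrier (automaton_group A) = generate tree_group {state_map A p, state_map A q}"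
proof -
  have "state_map A ` states A \<subseteq> carrier tree_group" using state_map_closed by blast
  then show ?thesis
    by (simp add: automaton_group_def carrier_subgroup_generated Int_absorb1 states)
qed

lemma quotient_finite_order:
  assumes "bounded_alphabet (alphabet A)"
  shows "\<exists>n::nat. n > 0 \<and>
    (inv\<^bsub>automaton_group A\<^esub> state_map A p \<otimes>\<^bsub>automaton_group A\<^esub> state_map A q)
      [^]\<^bsub>automaton_group A\<^esub> n = \<one>\<^bsub>automaton_group A\<^esub>"
proof -
  have p: "p \<in> states A" and q: "other p = q" by (simp_all add: states other_def)
  have "state_map A p \<in> carrier (automaton_group A)"
    unfolding carrier_automaton_group by (rule generate.incl) simp
  then have "inv\<^bsub>automaton_group A\<^esub> state_map A p = inv\<^bsub>tree_group\<^esub> state_map A p"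
    unfolding automaton_group_def by (rule group.inv_subgroup_generated[OF group_BijGroup])
  moreover obtain n :: nat where "n > 0"
    "state_map quotient_automaton p [^]\<^bsub>tree_group\<^esub> n = \<one>\<^bsub>tree_group\<^esub>"
    using state_map_finite_order[OF quotient_is_automaton quotient_invertible, of p] assms p
      transition_out_quotient by auto
  ultimately show ?thesis
    using state_map_quotient[OF p] q
    by (auto simp: automaton_group_def pow_subgroup_generated)
qed

lemma not_free_if_bounded:
  assumes "bounded_alphabet (alphabet A)"
  shows "\<not> automaton_group A \<cong> free_group {..<2::nat}"
proof -
  interpret T: group tree_group by (rule group_BijGroup)
  interpret group "automaton_group A" by (simp add: automaton_group_def)
  have in_group: "state_map A p \<in> carrier (automaton_group A)"
    "state_map A q \<in> carrier (automaton_group A)"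
    unfolding carrier_automaton_group by (auto intro: generate.incl)
  \<comment> \<open>The criterion asks for generation inside the automaton group itself, not inside
    the ambient permutation group.\<close>
  have "carrier (automaton_group A) =
      generate (automaton_group A) {state_map A p, state_map A q}"
    using T.subgroup_generated2[of "state_map A ` states A"] in_group
      carrier_subgroup_generated[of "automaton_group A" "state_map A ` states A"]
    by (simp add: automaton_group_def states Int_absorb1)
  with quotient_finite_order[OF assms] in_group show ?thesis
    using two_generated_torsion_quotient_not_free by blast
qed

text \<open>Equality spreads from level 0 to all levels: by reversibility, any two states at level
  \<open>Suc i\<close> are reached from states at level \<open>i\<close> by the same letter
  \<open>x\<close>, and runs that agree on \<open>x # w\<close> have agreeing tails.\<close>

lemma run_eq_if_state_map_eq:
  assumes eq: "state_map A p = state_map A q"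
  shows "s \<in> states A \<Longrightarrow> t \<in> states A \<Longrightarrow> \<forall>j < length w. w ! j \<in> alphabet A (i + j) \<Longrightarrow>
    run A i s w = run A i t w"
proof (induction i arbitrary: s t w)
  case 0
  then show ?case
    using fun_cong[OF eq, of w] states by (auto simp: state_map_def tree_words_def)
next
  case (Suc i)
  obtain x where x: "x \<in> alphabet A i"
    using automaton by (fastforce simp: is_automaton_def changing_alphabet_def)
  then have "bij_betw (\<lambda>q. transition A i q x) (states A) (states A)"
    using bireversible by (simp add: bireversible_automaton_def reversible_automaton_def)
  then have ex: "u \<in> (\<lambda>q. transition A i q x) ` states A" if "u \<in> states A" for u
    using that by (simp add: bij_betw_def)
  then obtain s' t' where st: "s' \<in> states A" "t' \<in> states A"
    "s = transition A i s' x" "t = transition A i t' x"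
    using ex[OF Suc.prems(1)] ex[OF Suc.prems(2)] by blast
  have "\<forall>j < length (x # w). (x # w) ! j \<in> alphabet A (i + j)"
    using Suc.prems(3) x by (auto simp: nth_Cons split: nat.splits)
  from Suc.IH[OF st(1,2) this] show ?case using st by simp
qed

lemma finite_if_state_map_eq:
  assumes bdd: "bounded_alphabet (alphabet A)" and eq: "state_map A p = state_map A q"
  shows "finite (carrier (automaton_group A))"
proof -
  interpret group tree_group by (rule group_BijGroup)
  have out_eq: "out A i s x = out A i p x" if "s \<in> states A" "x \<in> alphabet A i" for i s x
    using run_eq_if_state_map_eq[OF eq that(1), of p "[x]" i] that states by simp
  \<comment> \<open>Outputs do not depend on the state, so freezing the state leaves the state map
    of \<open>p\<close> unchanged and makes the condition on transitions in
    \<open>state_map_finite_order\<close> trivial.\<close>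
  let ?B = "A\<lparr>transition := \<lambda>i q x. q\<rparr>"
  have B: "is_automaton ?B" "invertible_automaton ?B"
    using automaton invertible by (auto simp: is_automaton_def invertible_automaton_def)
  have "run ?B i p w = run A i s w"
    if "s \<in> states A" "\<forall>j < length w. w ! j \<in> alphabet A (i + j)" for i s w
    using that
  proof (induction w arbitrary: i s)
    case (Cons x w)
    have x: "x \<in> alphabet A i" and w: "\<forall>j < length w. w ! j \<in> alphabet A (Suc i + j)"
      using Cons.prems(2) by force+
    show ?case
      using Cons.IH[OF transition_in_states[OF Cons.prems(1) x] w] out_eq[OF Cons.prems(1) x]
      by simp
  qed simp
  from this[of p _ 0] have "state_map ?B p = state_map A p"
    by (auto simp: state_map_def tree_words_def states restrict_def fun_eq_iff)
  then obtain n :: nat where "n > 0" "state_map A p [^]\<^bsub>tree_group\<^esub> n = \<one>\<^bsub>tree_group\<^esub>"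
    using state_map_finite_order[OF B, of p] bdd states by auto
  then have "finite (carrier (subgroup_generated tree_group {state_map A p}))"
    using finite_cyclic_subgroup[OF state_map_closed[of p]] states by auto
  then show ?thesis
    using eq by (simp add: automaton_group_def states)
qed

end

section \<open>Permutations separating short words\<close>

lemma ex_bij_betw_extending:
  assumes X: "finite X" and D: "D \<subseteq> X" "p ` D \<subseteq> X" "inj_on p D"
  shows "\<exists>f. bij_betw f X X \<and> (\<forall>x \<in> D. f x = p x)"
proof -
  have "card (X - D) = card (X - p ` D)"
    using X D by (simp add: card_Diff_subset finite_subset card_image)
  then obtain g where g: "bij_betw g (X - D) (X - p ` D)"
    using finite_same_card_bij[of "X - D" "X - p ` D"] X by auto
  let ?f = "\<lambda>x. if x \<in> D then p x else g x"
  have "bij_betw ?f D (p ` D)" using D(3) by (simp add: bij_betw_def inj_on_def)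
  moreover have "bij_betw ?f (X - D) (X - p ` D)"
    using g bij_betw_cong[of "X - D" ?f g] by simp
  ultimately have "bij_betw ?f (D \<union> (X - D)) (p ` D \<union> (X - p ` D))"
    by (rule bij_betw_combine) auto
  then show ?thesis using D by (intro exI[of _ ?f]) (simp add: Un_absorb1)
qed

text \<open>The ball around the identity in the Cayley graph of the free group; the length of a
  reduced word is its distance from the centre.\<close>

definition free_ball :: "'s set \<Rightarrow> nat \<Rightarrow> (bool \<times> 's) list set" where
  "free_ball S m = {w \<in> carrier (free_group S). length w \<le> m}"

lemma finite_free_ball: "finite S \<Longrightarrow> finite (free_ball S m)"
  by (rule finite_subset[OF _ finite_lists_length_le[of "UNIV \<times> S" m]])
    (auto simp: free_ball_def free_group_def)

lemma reduced_Cons_inj: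
  assumes "reduced v" "reduced w" "reduced_Cons x v = reduced_Cons x w"
  shows "v = w"
  using reduced_Cons_cancel[of v "inv_letter x"] reduced_Cons_cancel[of w "inv_letter x"] assms
  by simp

text \<open>The ball is copied into \<open>X\<close> by an injection \<open>h\<close>, and each
  generator acts on the copy by left multiplication wherever this stays in the ball. A word
  \<open>w\<close> then carries the centre \<open>h []\<close> to \<open>h w\<close>.\<close>

lemma ex_bij_separating_ball:
  assumes X: "finite X" and S: "finite S" and card: "card (free_ball S m) \<le> card X"
  shows "\<exists>c. (\<forall>s. c s \<in> Bij X) \<and>
    (\<exists>x \<in> X. \<forall>w \<in> free_ball S m. w \<noteq> [] \<longrightarrow> free_eval (BijGroup X) c w x \<noteq> x)"
proof -
  let ?B = "free_ball S m"
  obtain h where h: "h ` ?B \<subseteq> X" "inj_on h ?B"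
    using card_le_inj[OF finite_free_ball[OF S] X card] by blast
  let ?D = "\<lambda>s. {w \<in> ?B. reduced_Cons (True, s) w \<in> ?B}"
  have red: "reduced w" if "w \<in> ?B" for w using that by (simp add: free_ball_def free_group_def)
  have "\<exists>f. f \<in> Bij X \<and> (\<forall>w \<in> ?D s. f (h w) = h (reduced_Cons (True, s) w))" for s
  proof -
    let ?p = "\<lambda>y. h (reduced_Cons (True, s) (inv_into ?B h y))"
    have inv_h: "inv_into ?B h (h w) = w" if "w \<in> ?B" for w using h(2) that by simp
    have "inj_on ?p (h ` ?D s)"
    proof (rule inj_onI)
      fix y z assume "y \<in> h ` ?D s" "z \<in> h ` ?D s" and eq: "?p y = ?p z"
      then obtain v w where vw: "v \<in> ?D s" "w \<in> ?D s" "y = h v" "z = h w" by blast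
      then have "reduced_Cons (True, s) v = reduced_Cons (True, s) w"
        using eq inv_h h(2) by (simp add: inj_on_eq_iff)
      then show "y = z" using vw red reduced_Cons_inj by blast
    qed
    then obtain f where f: "bij_betw f X X" "\<forall>y \<in> h ` ?D s. f y = ?p y"
      using ex_bij_betw_extending[OF X, of "h ` ?D s" ?p] h(1) inv_h by (auto simp: image_subset_iff)
    have "restrict f X \<in> Bij X" using f(1) by (simp add: Bij_def)
    moreover have "restrict f X (h w) = h (reduced_Cons (True, s) w)" if "w \<in> ?D s" for w
      using that f(2) h(1) inv_h by auto
    ultimately show ?thesis by blast
  qed
  then have "\<forall>s. \<exists>f. f \<in> Bij X \<and> (\<forall>w \<in> ?D s. f (h w) = h (reduced_Cons (True, s) w))"
    by blast
  from choice[OF this] obtain c where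
    "\<forall>s. c s \<in> Bij X \<and> (\<forall>w \<in> ?D s. c s (h w) = h (reduced_Cons (True, s) w))" ..
  then have c: "\<And>s. c s \<in> Bij X"
    "\<And>s w. w \<in> ?D s \<Longrightarrow> c s (h w) = h (reduced_Cons (True, s) w)" by blast+
  interpret group "BijGroup X" by (rule group_BijGroup)
  have Nil: "[] \<in> ?B" by (simp add: free_ball_def free_group_def)
  \<comment> \<open>The right factor acts first, so the path from the centre visits the suffixes of
    \<open>w\<close>, which are reduced words in the ball.\<close>
  have eval: "free_eval (BijGroup X) c w (h []) = h w" if "w \<in> ?B" for w
    using that
  proof (induction w)
    case Nil
    then show ?case using h by auto
  next
    case (Cons x w)
    have w: "w \<in> ?B"
      using Cons.prems by (auto simp: free_ball_def free_group_def dest: reduced_tl)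
    have hX: "h [] \<in> X" "h w \<in> X" "h (x # w) \<in> X" using h(1) Nil w Cons.prems by auto
    obtain b s where x: "x = (b, s)" by (cases x)
    show ?case
    proof (cases b)
      case True
      have "reduced_Cons x w = x # w"
        using red[OF Cons.prems] by (rule reduced_Cons_reduced)
      then have "c s (h w) = h (x # w)"
        using c(2)[of w s] x True w Cons.prems by simp
      then show ?thesis
        using True x Cons.IH[OF w] free_eval_BijGroup_Cons[of c UNIV X x w] c(1) hX
        by (simp del: free_eval_Cons add: image_subset_iff)
    next
      case False
      \<comment> \<open>For an inverse letter the edge is read backwards: the generator
        \<open>s\<close> moves \<open>h (x # w)\<close> to \<open>h w\<close>.\<close>
      then have "inv_letter x = (True, s)" by (simp add: inv_letter_def x)
      moreover have "reduced_Cons (inv_letter x) (x # w) = w" by simp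
      ultimately have "c s (h (x # w)) = h w"
        using c(2)[of "x # w" s] w Cons.prems by simp
      moreover have "inj_on (c s) X" using c(1) by (simp add: Bij_def bij_betw_def)
      ultimately have "inv_into X (c s) (h w) = h (x # w)"
        using hX by (metis inv_into_f_f)
      then show ?thesis
        using False x Cons.IH[OF w] free_eval_BijGroup_Cons[of c UNIV X x w] c(1) hX
        by (simp del: free_eval_Cons add: image_subset_iff)
    qed
  qed
  show ?thesis
  proof (intro exI[of _ c] conjI allI bexI[of _ "h []"] ballI impI)
    fix w assume "w \<in> ?B" "w \<noteq> []"
    then show "free_eval (BijGroup X) c w (h []) \<noteq> h []"
      using eval h(2) Nil by (simp add: inj_on_eq_iff)
  qed (use c(1) h(1) Nil in auto)
qed

text \<open>
  Since \<open>S\<close> may be empty, only the bound \<open>m \<le> card X\<close> makes the set of fitting radii finite.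
\<close>

lemma ex_bij_separating_all_fitting_balls:
  assumes X: "finite X" and S: "finite S"
  shows "\<exists>c. (\<forall>s. c s \<in> Bij X) \<and> (\<forall>m \<le> card X. card (free_ball S m) \<le> card X \<longrightarrow>
    (\<forall>w \<in> free_ball S m. w \<noteq> [] \<longrightarrow> (\<exists>x \<in> X. free_eval (BijGroup X) c w x \<noteq> x)))"
proof -
  let ?M = "{m. m \<le> card X \<and> card (free_ball S m) \<le> card X}"
  show ?thesis
  proof (cases "?M = {}")
    case True
    then show ?thesis using id_Bij[of X] by (intro exI[of _ "\<lambda>s. \<lambda>x \<in> X. x"]) auto
  next
    case False
    have fin: "finite ?M" by simp
    \<comment> \<open>Balls are nested, so permutations for the largest fitting radius serve all
      smaller ones.\<close>
    obtain c x where c: "\<forall>s. c s \<in> Bij X" "x \<in> X"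
      "\<forall>w \<in> free_ball S (Max ?M). w \<noteq> [] \<longrightarrow> free_eval (BijGroup X) c w x \<noteq> x"
      using ex_bij_separating_ball[OF X S, of "Max ?M"] Max_in[OF fin False] by blast
    have "free_ball S m \<subseteq> free_ball S (Max ?M)" if "m \<in> ?M" for m
      using Max_ge[OF fin that] by (auto simp: free_ball_def)
    then show ?thesis using c by (intro exI[of _ c]) blast
  qed
qed

section \<open>A free group over an unbounded alphabet\<close>

locale level_permutations =
  fixes Xs :: "nat \<Rightarrow> 'a set" and S :: "'s set" and c :: "nat \<Rightarrow> 's \<Rightarrow> 'a \<Rightarrow> 'a"
  assumes alphabet: "changing_alphabet Xs" and finite_S: "finite S"
    and c_Bij: "c i s \<in> Bij (Xs i)"
begin

text \<open>Letters act on the states as the identity, also in the inverse automaton, so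
  bi-reversibility holds for any choice of level permutations.\<close>

definition constant_state_automaton :: "('s, 'a) automaton" where
  "constant_state_automaton =
     \<lparr>alphabet = Xs, states = S, transition = \<lambda>i s x. s, out = c\<rparr>"

lemma constant_state_automaton_simps [simp]:
  "alphabet constant_state_automaton = Xs"
  "states constant_state_automaton = S"
  "transition constant_state_automaton i s x = s"
  "out constant_state_automaton = c"
  by (simp_all add: constant_state_automaton_def)

lemma is_automaton: "is_automaton constant_state_automaton"
  using alphabet finite_S Bij_imp_funcset[OF c_Bij] by (auto simp: is_automaton_def)

lemma bireversible: "bireversible_automaton constant_state_automaton"
  using c_Bij
  by (auto simp: bireversible_automaton_def invertible_automaton_def reversible_automaton_def
      inverse_automaton_def Bij_def bij_betw_def)

lemma run_length: "length (run constant_state_automaton i s w) = length w"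
  by (induction w arbitrary: i) auto

lemma run_nth: "j < length w \<Longrightarrow> run constant_state_automaton i s w ! j = c (i + j) s (w ! j)"
  by (induction w arbitrary: i j) (auto simp: nth_Cons split: nat.splits)

abbreviation tree_group where "tree_group \<equiv> BijGroup (tree_words Xs)"

lemma state_map_closed: "s \<in> S \<Longrightarrow> state_map constant_state_automaton s \<in> Bij (tree_words Xs)"
  using state_map_Bij[OF is_automaton] bireversible
  by (simp add: bireversible_automaton_def BijGroup_def)

text \<open>Without state changes the tree group computation splits into independent computations at
  each position.\<close>

lemma free_eval_nth:
  assumes w: "snd ` set w \<subseteq> S" and u: "u \<in> tree_words Xs" and i: "i < length u"
  shows "length (free_eval tree_group (state_map constant_state_automaton) w u) = length u"
    and "free_eval tree_group (state_map constant_state_automaton) w u ! i =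
      free_eval (BijGroup (Xs i)) (c i) w (u ! i)"
proof -
  let ?W = "tree_words Xs" and ?a = "state_map constant_state_automaton"
  let ?F = "free_eval tree_group ?a" and ?f = "free_eval (BijGroup (Xs i)) (c i)"
  have length: "length (?a s z) = length z" if "z \<in> ?W" for s z
    using that by (simp add: state_map_def run_length)
  have nth: "?a s z ! i = c i s (z ! i)" if "z \<in> ?W" "i < length z" for s z
    using that run_nth[of i z 0 s] by (simp add: state_map_def)
  have "length (?F w u) = length u \<and> ?F w u ! i = ?f w (u ! i)"
    using w
  proof (induction w)
    case Nil
    then show ?case using u i by (simp add: tree_words_def)
  next
    case (Cons x w)
    let ?s = "snd x" and ?v = "?F w u"
    have s: "?s \<in> S" and w: "snd ` set w \<subseteq> S" using Cons.prems by auto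
    have F: "?F w \<in> Bij ?W"
      using group.free_eval_closed[OF group_BijGroup, of ?a S ?W w] state_map_closed w
      by auto
    have v: "?v \<in> ?W" using Bij_imp_funcset[OF F] u by auto
    have ui: "u ! i \<in> Xs i" using u i by (simp add: tree_words_def)
    have eval: "?F (x # w) u = (if fst x then ?a ?s else inv_into ?W (?a ?s)) ?v"
      by (rule free_eval_BijGroup_Cons[of _ S]) (use Cons.prems u state_map_closed in auto)
    have eval_level: "?f (x # w) (u ! i) =
        (if fst x then c i ?s else inv_into (Xs i) (c i ?s)) (?f w (u ! i))"
      by (rule free_eval_BijGroup_Cons[of _ S]) (use Cons.prems ui c_Bij in auto)
    have IH: "length ?v = length u" "?v ! i = ?f w (u ! i)" using Cons.IH[OF w] by auto
    show ?case
    proof (cases "fst x")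
      case True
      then show ?thesis
        unfolding eval eval_level using IH length[OF v] nth[OF v] i by simp
    next
      case False
      \<comment> \<open>The inverse is handled through the preimage \<open>?z\<close> of
        \<open>?v\<close>: comparing letters at position \<open>i\<close> shows that its letter
        there is the preimage at that level.\<close>
      let ?z = "inv_into ?W (?a ?s) ?v"
      have z: "?z \<in> ?W" "?a ?s ?z = ?v"
        using state_map_closed[OF s] v Bij_inv_into_mem bij_betw_inv_into_right
        by (fastforce simp: Bij_def)+
      then have len: "length ?z = length u" using length[OF z(1), of ?s] z(2) IH(1) by simp
      have "?z ! i \<in> Xs i" using z(1) len i by (simp add: tree_words_def)
      moreover have "bij_betw (c i ?s) (Xs i) (Xs i)" using c_Bij by (simp add: Bij_def)
      ultimately have "inv_into (Xs i) (c i ?s) (c i ?s (?z ! i)) = ?z ! i"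
        by (rule bij_betw_inv_into_left[rotated])
      moreover have "c i ?s (?z ! i) = ?f w (u ! i)"
        using nth[OF z(1), of ?s, symmetric] len i z(2) IH(2) by simp
      ultimately have "inv_into (Xs i) (c i ?s) (?f w (u ! i)) = ?z ! i" by (simp only:)
      then show ?thesis
        unfolding eval eval_level using False len by simp
    qed
  qed
  then show "length (?F w u) = length u" "?F w u ! i = ?f w (u ! i)" by auto
qed

lemma automaton_group_free:
  assumes sep: "\<And>w. w \<in> carrier (free_group S) \<Longrightarrow> w \<noteq> [] \<Longrightarrow>
    \<exists>i. \<exists>x \<in> Xs i. free_eval (BijGroup (Xs i)) (c i) w x \<noteq> x"
  shows "automaton_group constant_state_automaton \<cong> free_group S"
proof -
  let ?a = "state_map constant_state_automaton"
  have "w = []" if w: "w \<in> carrier (free_group S)"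
    and eval: "free_eval tree_group ?a w = \<one>\<^bsub>tree_group\<^esub>" for w
  proof (rule ccontr)
    assume "w \<noteq> []"
    with sep w obtain i x where x: "x \<in> Xs i" "free_eval (BijGroup (Xs i)) (c i) w x \<noteq> x"
      by blast
    have "\<forall>j. \<exists>y. y \<in> Xs j"
      using alphabet by (auto simp: changing_alphabet_def)
    from choice[OF this] obtain y where y: "\<And>j. y j \<in> Xs j" by blast
    \<comment> \<open>Length \<open>Suc i\<close> makes position \<open>i\<close> the last one; the
      moved letter \<open>x\<close> stands there, and arbitrary letters fill the earlier
      positions.\<close>
    define u where "u = map (\<lambda>j. if j = i then x else y j) [0..<Suc i]"
    have u: "u \<in> tree_words Xs" "length u = Suc i" "u ! i = x"
      using x y by (auto simp: u_def tree_words_def simp del: upt_Suc)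
    have "free_eval tree_group ?a w u ! i = free_eval (BijGroup (Xs i)) (c i) w x"
      using free_eval_nth(2)[of w u i] w u by (simp add: free_group_def)
    then show False using eval u x by simp
  qed
  moreover have "?a ` S \<subseteq> carrier tree_group"
    using state_map_closed by auto
  ultimately show ?thesis
    using group.generated_iso_free_group[OF group_BijGroup, of ?a S "tree_words Xs"]
    by (simp add: automaton_group_def)
qed

end

text \<open>The permutations are fixed before any word is given: each level separates all words in
  the balls that fit into it, and by unboundedness every word lies in a ball fitting into some
  level.\<close>

lemma ex_automaton_free_group_if_unbounded:
  assumes Xs: "changing_alphabet Xs" and unbdd: "\<not> bounded_alphabet Xs" and S: "finite S"
  shows "\<exists>A :: ('s, 'a) automaton. is_automaton A \<and> alphabet A = Xs \<and> states A = S \<and>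
    bireversible_automaton A \<and> automaton_group A \<cong> free_group S"
proof -
  have "\<exists>c. (\<forall>s. c s \<in> Bij (Xs i)) \<and>
      (\<forall>m \<le> card (Xs i). card (free_ball S m) \<le> card (Xs i) \<longrightarrow>
        (\<forall>w \<in> free_ball S m. w \<noteq> [] \<longrightarrow>
          (\<exists>x \<in> Xs i. free_eval (BijGroup (Xs i)) c w x \<noteq> x)))" for i
    using Xs S by (intro ex_bij_separating_all_fitting_balls) (auto simp: changing_alphabet_def)
  then obtain c where c: "\<And>i s. c i s \<in> Bij (Xs i)"
    "\<And>i m w. m \<le> card (Xs i) \<Longrightarrow> card (free_ball S m) \<le> card (Xs i) \<Longrightarrow>
      w \<in> free_ball S m \<Longrightarrow> w \<noteq> [] \<Longrightarrow> \<exists>x \<in> Xs i. free_eval (BijGroup (Xs i)) (c i) w x \<noteq> x"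
    by metis
  interpret level_permutations Xs S c
    using Xs S c(1) by unfold_locales
  have "\<exists>i. \<exists>x \<in> Xs i. free_eval (BijGroup (Xs i)) (c i) w x \<noteq> x"
    if w: "w \<in> carrier (free_group S)" "w \<noteq> []" for w
  proof -
    let ?m = "length w"
    \<comment> \<open>The maximum covers both size conditions on the radius at once.\<close>
    obtain i where "max ?m (card (free_ball S ?m)) \<le> card (Xs i)"
      using unbdd unfolding bounded_alphabet_def bdd_above_def by (metis nle_le rangeE)
    then show ?thesis using c(2)[of ?m i w] w by (auto simp: free_ball_def)
  qed
  from automaton_group_free[OF this] show ?thesis
    using is_automaton bireversible by (intro exI[of _ constant_state_automaton]) simp
qed

section \<open>Freeness for two states: changing alphabets and the Mealy case\<close>

lemma two_state_bireversible_not_free_if_bounded: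
  assumes "is_automaton A" "bireversible_automaton A" "card (states A) = 2"
    and "bounded_alphabet (alphabet A)"
  shows "\<not> automaton_group A \<cong> free_group {..<2::nat}"
proof -
  obtain p q where "states A = {p, q}" "p \<noteq> q" using assms(3) by (auto simp: card_2_iff)
  then interpret two_state_bireversible A p q using assms by unfold_locales
  show ?thesis by (rule not_free_if_bounded[OF assms(4)])
qed

theorem theorem3:
  fixes Xs :: "nat \<Rightarrow> 'a set"
  assumes "changing_alphabet Xs"
  shows
    "((\<exists>A :: (nat, 'a) automaton.
          is_automaton A \<and> alphabet A = Xs \<and> card (states A) = 2 \<and>
          bireversible_automaton A \<and> automaton_group A \<cong> free_group {..<2::nat})
        \<longleftrightarrow> \<not> bounded_alphabet Xs)
     \<and> (bounded_alphabet Xs \<longrightarrow>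
          (\<forall>(A :: ('q, 'a) automaton) q\<^sub>1 q\<^sub>2.
             is_automaton A \<and> alphabet A = Xs \<and> states A = {q\<^sub>1, q\<^sub>2} \<and> q\<^sub>1 \<noteq> q\<^sub>2 \<and>
             bireversible_automaton A \<longrightarrow>
               (\<exists>n::nat. n > 0 \<and>
                  (inv\<^bsub>automaton_group A\<^esub> (state_map A q\<^sub>1) \<otimes>\<^bsub>automaton_group A\<^esub> state_map A q\<^sub>2)
                    [^]\<^bsub>automaton_group A\<^esub> n = \<one>\<^bsub>automaton_group A\<^esub>) \<and>
               (state_map A q\<^sub>1 = state_map A q\<^sub>2 \<longrightarrow> finite (carrier (automaton_group A)))))
     \<and> \<not> (\<exists>A :: ('q, 'a) automaton.
          is_automaton A \<and> mealy A \<and> card (states A) = 2 \<and>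
          bireversible_automaton A \<and> automaton_group A \<cong> free_group {..<2::nat})"
proof (intro conjI iffI impI allI)
  assume "\<exists>A :: (nat, 'a) automaton. is_automaton A \<and> alphabet A = Xs \<and> card (states A) = 2 \<and>
    bireversible_automaton A \<and> automaton_group A \<cong> free_group {..<2::nat}"
  then show "\<not> bounded_alphabet Xs"
    using two_state_bireversible_not_free_if_bounded by blast
next
  assume "\<not> bounded_alphabet Xs"
  then show "\<exists>A :: (nat, 'a) automaton. is_automaton A \<and> alphabet A = Xs \<and> card (states A) = 2 \<and>
    bireversible_automaton A \<and> automaton_group A \<cong> free_group {..<2::nat}"
    using ex_automaton_free_group_if_unbounded[OF assms, of "{..<2::nat}"]
    by (metis card_lessThan finite_lessThan)
next
  fix A :: "('q, 'a) automaton" and q\<^sub>1 q\<^sub>2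
  assume bdd: "bounded_alphabet Xs" and A: "is_automaton A \<and> alphabet A = Xs \<and>
    states A = {q\<^sub>1, q\<^sub>2} \<and> q\<^sub>1 \<noteq> q\<^sub>2 \<and> bireversible_automaton A"
  interpret two_state_bireversible A q\<^sub>1 q\<^sub>2 using A by unfold_locales auto
  show "\<exists>n::nat. n > 0 \<and>
      (inv\<^bsub>automaton_group A\<^esub> (state_map A q\<^sub>1) \<otimes>\<^bsub>automaton_group A\<^esub> state_map A q\<^sub>2)
        [^]\<^bsub>automaton_group A\<^esub> n = \<one>\<^bsub>automaton_group A\<^esub>"
    using quotient_finite_order bdd A by simp
  show "finite (carrier (automaton_group A))" if "state_map A q\<^sub>1 = state_map A q\<^sub>2"
    using finite_if_state_map_eq that bdd A by simp
next
  show "\<not> (\<exists>A :: ('q, 'a) automaton. is_automaton A \<and> mealy A \<and> card (states A) = 2 \<and>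
    bireversible_automaton A \<and> automaton_group A \<cong> free_group {..<2::nat})"
  proof
    assume "\<exists>A :: ('q, 'a) automaton. is_automaton A \<and> mealy A \<and> card (states A) = 2 \<and>
      bireversible_automaton A \<and> automaton_group A \<cong> free_group {..<2::nat}"
    then obtain A :: "('q, 'a) automaton" where A: "is_automaton A" "mealy A"
      "card (states A) = 2" "bireversible_automaton A" "automaton_group A \<cong> free_group {..<2::nat}"
      by blast
    \<comment> \<open>A Mealy automaton has a constant alphabet, which is bounded; it is the
      alphabet of \<open>A\<close> and is not tied to \<open>Xs\<close>.\<close>
    have "card (alphabet A i) \<le> card (alphabet A 0)" for i
      using A(2) by (metis mealy_def order_refl)
    then have "bounded_alphabet (alphabet A)"
      by (auto simp: bounded_alphabet_def bdd_above_def intro!: exI[of _ "card (alphabet A 0)"])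
    then show False
      using two_state_bireversible_not_free_if_bounded A by blast
  qed
qed

end
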